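(* Consider the setting and Algorithm DRDGA described in the context, under Assumptions A1 and A2, with stepsize $\beta[t]=q/t$ for $t=1,2,\dots$, where the constant $q>0$ satisfies $q\gamma/m\ge 4$, $\gamma:=\sum_{j=1}^m\gamma_j$. Let $D$ be a constant with $\sup_t\|\lambda_i[t]\|\le D$ for all $i$ (which exists by Theorem 1), let $B:=\max_{1\le i\le m}\sqrt{p}\,(G_i+\gamma_iD)$, and let $\delta$, $\eta$ be as in the context. Then for all $T\ge 2$, $$F(\widehat{\mathbf{x}}[T])-F(\mathbf{x}^* )\le \frac{32}{T\delta}\sum_{i=1}^m(G_i+\gamma_iD)\left(\frac{\eta}{1-\eta}\sum_{i=1}^m\|\theta_i[0]\|_1+\frac{qmB}{1-\eta}(1+\ln T)\right)+\frac{q}{T}\sum_{i=1}^m(G_i+\gamma_iD)^2,$$ where $\mathbf{x}^*$ is an optimal solution of the problem.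
   Context: Problem: $m$ agents; agent $i$ has a function $f_i:\mathbb{R}^{n_i}\to\mathbb{R}$, a set $\mathbf{X}_i\subseteq\mathbb{R}^{n_i}$, a matrix $A_i\in\mathbb{R}^{p\times n_i}$ and a vector $\mathbf{b}_i\in\mathbb{R}^p$. The problem is $\min_{\mathbf{x}_i\in\mathbf{X}_i,\,i=1,\dots,m} F(\mathbf{x}):=\sum_{i=1}^m f_i(\mathbf{x}_i)$ subject to $\sum_{i=1}^m (A_i\mathbf{x}_i-\mathbf{b}_i)=0$, where $\mathbf{x}=(\mathbf{x}_1,\dots,\mathbf{x}_m)$. Regularization parameters $\gamma_i>0$ are fixed; $\mathcal{L}_i(\mathbf{x}_i,\lambda)=f_i(\mathbf{x}_i)+\lambda^\top(A_i\mathbf{x}_i-\mathbf{b}_i)-\frac{\gamma_i}{2}\lambda^\top\lambda$ for $\lambda\in\mathbb{R}^p$. Assumption A1: each $f_i$ is $\tau_i$-strongly convex ($\tau_i>0$), and each $\mathbf{X}_i$ is nonempty, convex and compact. $G_i>0$ denote constants with $\|A_i\mathbf{x}_i-\mathbf{b}_i\|\le G_i$ for all $\mathbf{x}_i\in\mathbf{X}_i$. Network: a sequence of directed graphs $\mathcal{G}[t]=(\{1,\dots,m\},\mathcal{E}[t])$. Out-neighbors $\mathcal{N}_i^{out}[t]=\{j:(i,j)\in\mathcal{E}[t]\}\cup\{i\}$, in-neighbors $\mathcal{N}_i^{in}[t]=\{j:(j,i)\in\mathcal{E}[t]\}\cup\{i\}$, out-degree $d_i[t]=|\mathcal{N}_i^{out}[t]|$.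 Weight matrix $W[t]$: $(W[t])_{ij}=1/d_j[t]$ if $j\in\mathcal{N}_i^{in}[t]$ and $0$ otherwise (column stochastic). Assumption A2: each agent $i$ knows $d_i[t]$ for every $t$, and there is an integer $B_c>0$ such that for every $k\ge0$ the graph with edge set $\bigcup_{l=kB_c}^{(k+1)B_c-1}\mathcal{E}[l]$ is strongly connected. Constants: $\delta:=\inf_{t\ge0}\min_{1\le i\le m}(W[t]W[t-1]\cdots W[0]\mathbf{1})_i$, which satisfies $\delta\ge 1/m^{mB_c}$; and $\eta:=(1-1/m^{mB_c})^{1/(mB_c)}\in(0,1)$. Algorithm DRDGA: initialize $\theta_i[0]\in\mathbb{R}^p$ and $\rho_i[0]=1$. For $t=0,1,\dots$ and each $i$: $\mathbf{u}_i[t+1]=\sum_j (W[t])_{ij}\theta_j[t]$; $\rho_i[t+1]=\sum_j (W[t])_{ij}\rho_j[t]$; $\lambda_i[t+1]=\mathbf{u}_i[t+1]/\rho_i[t+1]$; $\mathbf{x}_i[t+1]=\arg\min_{\mathbf{x}_i\in\mathbf{X}_i}\mathcal{L}_i(\mathbf{x}_i,\lambda_i[t+1])$; $\theta_i[t+1]=\mathbf{u}_i[t+1]+\beta[t+1](A_i\mathbf{x}_i[t+1]-\mathbf{b}_i-\gamma_i\lambda_i[t+1])$. Averaged primal iterates: for $T\ge2$, $\widehat{\mathbf{x}}_i[T]=\frac{\sum_{t=1}^T (t-1)\mathbf{x}_i[t]}{T(T-1)/2}$, and $\widehat{\mathbf{x}}[T]=(\widehat{\mathbf{x}}_1[T],\dots,\widehat{\mathbf{x}}_m[T])$.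 $\|\cdot\|_1$ is the $\ell_1$ norm. *)

theory Defs
  imports "HOL-Analysis.Analysis"
begin

text \<open>Agents are indexed by 0..m-1.  A vector of R^n (n = n_i) is represented as a
function nat => real vanishing from coordinate n on; the dual space R^p is real^'p.\<close>

definition Rn :: "nat \<Rightarrow> (nat \<Rightarrow> real) set" where
  "Rn n = {x. \<forall>k\<ge>n. x k = 0}"

definition enorm :: "nat \<Rightarrow> (nat \<Rightarrow> real) \<Rightarrow> real" where
  "enorm n x = sqrt (\<Sum>k<n. (x k)\<^sup>2)"

definition comb :: "real \<Rightarrow> (nat \<Rightarrow> real) \<Rightarrow> (nat \<Rightarrow> real) \<Rightarrow> (nat \<Rightarrow> real)" where
  "comb a x y = (\<lambda>k. a * x k + (1 - a) * y k)"

text \<open>tau-strong convexity of f on R^n\<close>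
definition strongly_convex_Rn :: "nat \<Rightarrow> real \<Rightarrow> ((nat \<Rightarrow> real) \<Rightarrow> real) \<Rightarrow> bool" where
  "strongly_convex_Rn n \<tau> f \<longleftrightarrow>
     (\<forall>x\<in>Rn n. \<forall>y\<in>Rn n. \<forall>a\<in>{0..1}.
        f (comb a x y) \<le> a * f x + (1 - a) * f y - \<tau> / 2 * a * (1 - a) * (enorm n (\<lambda>k. x k - y k))\<^sup>2)"

text \<open>nonempty, convex, compact subset of R^n (compactness w.r.t. the product topology on
nat => real, which on Rn n coincides with the Euclidean topology)\<close>
definition ncc_set :: "nat \<Rightarrow> (nat \<Rightarrow> real) set \<Rightarrow> bool" where
  "ncc_set n X \<longleftrightarrow> X \<noteq> {} \<and> X \<subseteq> Rn n \<and>
     (\<forall>x\<in>X. \<forall>y\<in>X. \<forall>a\<in>{0..1}. comb a x y \<in> X) \<and> compact X"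

text \<open>A_i x for A_i a p x n_i matrix\<close>
definition matvec :: "nat \<Rightarrow> ('p \<Rightarrow> nat \<Rightarrow> real) \<Rightarrow> (nat \<Rightarrow> real) \<Rightarrow> real^'p::finite" where
  "matvec n A x = (\<chi> r. \<Sum>k<n. A r k * x k)"

text \<open>Lagrangian L_i(x, lambda)\<close>
definition Lag :: "((nat \<Rightarrow> real) \<Rightarrow> real) \<Rightarrow> nat \<Rightarrow> ('p \<Rightarrow> nat \<Rightarrow> real) \<Rightarrow> real^'p::finite
                    \<Rightarrow> real \<Rightarrow> (nat \<Rightarrow> real) \<Rightarrow> real^'p \<Rightarrow> real" where
  "Lag f n A b \<gamma> x lam = f x + lam \<bullet> (matvec n A x - b) - \<gamma> / 2 * (lam \<bullet> lam)"

text \<open>Graph notions; E t is the edge set of G[t] on vertices 0..m-1\<close>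
definition out_nbrs :: "nat \<Rightarrow> (nat \<Rightarrow> (nat \<times> nat) set) \<Rightarrow> nat \<Rightarrow> nat \<Rightarrow> nat set" where
  "out_nbrs m E t i = {j. j < m \<and> (i, j) \<in> E t} \<union> {i}"

definition in_nbrs :: "nat \<Rightarrow> (nat \<Rightarrow> (nat \<times> nat) set) \<Rightarrow> nat \<Rightarrow> nat \<Rightarrow> nat set" where
  "in_nbrs m E t i = {j. j < m \<and> (j, i) \<in> E t} \<union> {i}"

definition outdeg :: "nat \<Rightarrow> (nat \<Rightarrow> (nat \<times> nat) set) \<Rightarrow> nat \<Rightarrow> nat \<Rightarrow> nat" where
  "outdeg m E t i = card (out_nbrs m E t i)"

definition Wmat :: "nat \<Rightarrow> (nat \<Rightarrow> (nat \<times> nat) set) \<Rightarrow> nat \<Rightarrow> nat \<Rightarrow> nat \<Rightarrow> real" where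
  "Wmat m E t i j = (if j \<in> in_nbrs m E t i then 1 / real (outdeg m E t j) else 0)"

definition strongly_connected_on :: "nat \<Rightarrow> (nat \<times> nat) set \<Rightarrow> bool" where
  "strongly_connected_on m R \<longleftrightarrow> (\<forall>i<m. \<forall>j<m. (i, j) \<in> R\<^sup>*)"

text \<open>Assumption A2 (connectivity part) with constant Bc\<close>
definition B_connected :: "nat \<Rightarrow> (nat \<Rightarrow> (nat \<times> nat) set) \<Rightarrow> nat \<Rightarrow> bool" where
  "B_connected m E Bc \<longleftrightarrow> Bc > 0 \<and>
     (\<forall>k. strongly_connected_on m (\<Union>l\<in>{k * Bc .. (k + 1) * Bc - 1}. E l))"

text \<open>Wprod_one m E t = W[t] W[t-1] ... W[0] 1\<close>
fun Wprod_one :: "nat \<Rightarrow> (nat \<Rightarrow> (nat \<times> nat) set) \<Rightarrow> nat \<Rightarrow> nat \<Rightarrow> real" where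
  "Wprod_one m E 0 = (\<lambda>i. \<Sum>j<m. Wmat m E 0 i j)"
| "Wprod_one m E (Suc t) = (\<lambda>i. \<Sum>j<m. Wmat m E (Suc t) i j * Wprod_one m E t j)"

definition delta_const :: "nat \<Rightarrow> (nat \<Rightarrow> (nat \<times> nat) set) \<Rightarrow> real" where
  "delta_const m E = (INF t. Min ((\<lambda>i. Wprod_one m E t i) ` {..<m}))"

definition eta_const :: "nat \<Rightarrow> nat \<Rightarrow> real" where
  "eta_const m Bc = (1 - 1 / real m ^ (m * Bc)) powr (1 / real (m * Bc))"

definition l1norm :: "real^'p::finite \<Rightarrow> real" where
  "l1norm v = (\<Sum>r\<in>UNIV. \<bar>v $ r\<bar>)"

end

theory Submission
  imports Defs
begin

text \<open>Along a window of \<open>m Bc\<close> steps every entry of the product of weight matrices is at least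
\<open>m\<^bsup>-m Bc\<^esup>\<close>, so right multiplication by it shrinks the spread of each row by a fixed factor.
As the normalised mass \<open>\<rho>\<^sub>i / m\<close> is an average of the row entries, each \<open>\<lambda>\<^sub>i[t+1]\<close> tracks the
network average \<open>\<theta>[t]\<close> of the \<open>\<theta>\<^sub>i[t]\<close> up to a geometrically weighted sum of past perturbations.
The averages perform gradient ascent on the regularised dual. Comparing Lagrangian values at
\<open>x\<^sub>i[t]\<close> and \<open>x\<^sup>*\<^sub>i\<close> bounds the primal gap at time \<open>t\<close> by consensus error, the difference
\<open>m t / (2 q) (\<parallel>\<theta>[t-1]\<parallel>\<^sup>2 - \<parallel>\<theta>[t]\<parallel>\<^sup>2)\<close>, the term \<open>- \<gamma> \<parallel>\<theta>[t-1]\<parallel>\<^sup>2\<close> and \<open>O(1/t)\<close>.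
With weights \<open>t - 1\<close>, summation by parts leaves the coefficient \<open>t (m / q - \<gamma>) \<le> 0\<close> on
\<open>\<parallel>\<theta>[t]\<parallel>\<^sup>2\<close>, and Jensen's inequality passes to the averaged iterate.\<close>

subsection \<open>Products of column-stochastic matrices and push-sum consensus\<close>

locale column_stochastic =
  fixes m :: nat and W :: "nat \<Rightarrow> nat \<Rightarrow> nat \<Rightarrow> real"
  assumes W_nonneg: "i < m \<Longrightarrow> j < m \<Longrightarrow> 0 \<le> W t i j"
    and W_col: "j < m \<Longrightarrow> (\<Sum>i<m. W t i j) = 1"
begin

text \<open>\<open>P N s\<close> is the backward product \<open>W[s+N-1] \<cdots> W[s]\<close>.\<close>

fun P :: "nat \<Rightarrow> nat \<Rightarrow> nat \<Rightarrow> nat \<Rightarrow> real" where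
  "P 0 s i j = (if i = j then 1 else 0)"
| "P (Suc N) s i j = (\<Sum>k<m. W (s + N) i k * P N s k j)"

lemma P_nonneg: "i < m \<Longrightarrow> j < m \<Longrightarrow> 0 \<le> P N s i j"
  by (induction N arbitrary: i) (auto intro!: sum_nonneg mult_nonneg_nonneg W_nonneg)

lemma P_col: "j < m \<Longrightarrow> (\<Sum>i<m. P N s i j) = 1"
proof (induction N)
  case (Suc N)
  have "(\<Sum>i<m. P (Suc N) s i j) = (\<Sum>k<m. \<Sum>i<m. W (s + N) i k * P N s k j)"
    by (simp, rule sum.swap)
  also have "\<dots> = (\<Sum>k<m. P N s k j)"
    by (simp add: sum_distrib_right[symmetric] W_col)
  finally show ?case using Suc by simp
qed simp

lemma P_le_1:
  assumes "i < m" "j < m" shows "P N s i j \<le> 1"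
proof -
  have "P N s i j \<le> (\<Sum>i<m. P N s i j)"
    by (rule member_le_sum) (use assms in \<open>auto intro: P_nonneg\<close>)
  then show ?thesis using P_col assms by simp
qed

lemma P_comp: "i < m \<Longrightarrow> P (M + N) s i j = (\<Sum>k<m. P M (s + N) i k * P N s k j)"
proof (induction M arbitrary: i)
  case 0
  have "(\<Sum>k<m. P 0 (s + N) i k * P N s k j) = (\<Sum>k<m. if i = k then P N s k j else 0)"
    by (intro sum.cong) auto
  then show ?case using 0 by simp
next
  case (Suc M)
  have "P (Suc M + N) s i j
      = (\<Sum>k<m. W (s + N + M) i k * (\<Sum>l<m. P M (s + N) k l * P N s l j))"
    using Suc.IH by (simp add: add_ac)
  also have "\<dots> = (\<Sum>l<m. \<Sum>k<m. W (s + N + M) i k * P M (s + N) k l * P N s l j)"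
    by (simp add: sum_distrib_left mult.assoc, rule sum.swap)
  finally show ?case by (simp add: sum_distrib_right)
qed

text \<open>Let \<open>k0\<close> minimise \<open>r\<close>. Column \<open>j\<close> puts weight at
  least \<open>\<alpha>\<close> on \<open>k0\<close>, so its average of \<open>r\<close> exceeds the
  minimum by at most \<open>(1 - \<alpha>) * c\<close>, while no average falls below the
  minimum.\<close>

lemma row_gap_contraction:
  assumes Q: "\<And>k l. k < m \<Longrightarrow> l < m \<Longrightarrow> \<alpha> \<le> Q k l" "\<And>l. l < m \<Longrightarrow> (\<Sum>k<m. Q k l) = 1"
    and \<alpha>: "0 \<le> \<alpha>" and jl: "j < m" "l < m"
    and gap: "\<And>k k'. k < m \<Longrightarrow> k' < m \<Longrightarrow> r k - r k' \<le> c"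
  shows "(\<Sum>k<m. r k * Q k j) - (\<Sum>k<m. r k * Q k l) \<le> (1 - \<alpha>) * (c::real)"
proof -
  have ne: "r ` {..<m} \<noteq> {}" "finite (r ` {..<m})" using jl by auto
  obtain k0 where k0: "k0 < m" "r k0 = Min (r ` {..<m})" using Min_in[OF ne(2,1)] by auto
  have lo: "r k0 \<le> r k" if "k < m" for k using k0 that ne by simp
  have c0: "0 \<le> c" using gap[of j j] jl by simp
  have "(\<Sum>k<m. r k * Q k j) - r k0 = (\<Sum>k<m. (r k - r k0) * Q k j)"
    using Q(2)[OF jl(1)] by (simp add: left_diff_distrib sum_subtractf sum_distrib_left[symmetric])
  also have "\<dots> = (\<Sum>k\<in>{..<m} - {k0}. (r k - r k0) * Q k j)"
    using k0 by (simp add: sum.remove)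
  also have "\<dots> \<le> (\<Sum>k\<in>{..<m} - {k0}. c * Q k j)"
    using gap k0(1) Q(1) \<alpha> jl by (intro sum_mono mult_right_mono) (auto intro: order_trans)
  also have "\<dots> = c * (1 - Q k0 j)"
    using Q(2)[OF jl(1)] k0 by (simp add: sum_distrib_left[symmetric] sum_diff1)
  also have "\<dots> \<le> c * (1 - \<alpha>)"
    using c0 Q(1)[OF k0(1) jl(1)] by (intro mult_left_mono) auto
  finally have up: "(\<Sum>k<m. r k * Q k j) - r k0 \<le> (1 - \<alpha>) * c" by (simp add: mult.commute)
  have "r k0 = (\<Sum>k<m. r k0 * Q k l)" using Q(2)[OF jl(2)] by (simp add: sum_distrib_left[symmetric])
  also have "\<dots> \<le> (\<Sum>k<m. r k * Q k l)"
    using lo Q(1) \<alpha> jl by (intro sum_mono mult_right_mono) (auto intro: order_trans)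
  finally show ?thesis using up by linarith
qed

text \<open>Strong induction splitting off the earliest window of length \<open>L\<close>, the right
  factor of the product: by \<open>row_gap_contraction\<close> it shrinks the gap of the later
  factors by \<open>1 - \<alpha>\<close>. Below one window, entries between 0 and 1 suffice.\<close>

lemma P_row_gap_div:
  assumes pos: "\<And>s i j. i < m \<Longrightarrow> j < m \<Longrightarrow> \<alpha> \<le> P L s i j" and \<alpha>: "0 \<le> \<alpha>" and L: "0 < L"
  shows "i < m \<Longrightarrow> j < m \<Longrightarrow> l < m \<Longrightarrow> P N s i j - P N s i l \<le> (1 - \<alpha>) ^ (N div L)"
proof (induction N arbitrary: s j l rule: less_induct)
  case (less N)
  show ?case
  proof (cases "N < L")
    case True
    then show ?thesis using P_nonneg[OF less.prems(1,3), of N s] P_le_1[OF less.prems(1,2), of N s]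
      by simp
  next
    case False
    then obtain M where N: "N = M + L" by (metis add.commute le_Suc_ex not_less)
    have "P N s i j - P N s i l \<le> (1 - \<alpha>) * (1 - \<alpha>) ^ (M div L)"
      unfolding N P_comp[OF less.prems(1)]
      by (rule row_gap_contraction)
        (use less.prems pos P_col \<alpha> L N in \<open>auto intro!: less.IH\<close>)
    also have "\<dots> = (1 - \<alpha>) ^ (N div L)" using L N by simp
    finally show ?thesis .
  qed
qed

text \<open>Replacing the exponent \<open>N div L\<close> by \<open>N / L\<close> costs at most one
  factor \<open>1 / (1 - \<alpha>)\<close>, which is at most 2 since
  \<open>\<alpha> \<le> 1 / 2\<close>. With fewer than two agents there is a single column and the
  gap is 0.\<close>

lemma P_row_gap:
  assumes pos: "\<And>s i j. i < m \<Longrightarrow> j < m \<Longrightarrow> \<alpha> \<le> P L s i j" and \<alpha>: "0 < \<alpha>" "m \<ge> 2 \<Longrightarrow> \<alpha> \<le> 1 / 2"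
    and L: "0 < L" and ijl: "i < m" "j < m" "l < m"
  shows "P N s i j - P N s i l \<le> 2 * ((1 - \<alpha>) powr (1 / real L)) ^ N"
proof (cases "m \<ge> 2")
  case False
  then have "j = l" using ijl by linarith
  then show ?thesis by simp
next
  case True
  then have a: "1 / 2 \<le> 1 - \<alpha>" "1 - \<alpha> < 1" using \<alpha> by auto
  have "real N \<le> real L * (real (N div L) + 1)"
  proof -
    have "N \<le> L * (N div L + 1)"
      using dividend_less_div_times[OF L, of N] by (simp add: algebra_simps)
    then have "real N \<le> real (L * (N div L + 1))" by linarith
    then show ?thesis by (simp add: algebra_simps)
  qed
  then have e: "real N / real L - 1 \<le> real (N div L)" using L by (simp add: field_simps)
  have "P N s i j - P N s i l \<le> (1 - \<alpha>) ^ (N div L)"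
    by (rule P_row_gap_div) (use assms in auto)
  also have "\<dots> = (1 - \<alpha>) powr real (N div L)" using a by (simp add: powr_realpow)
  also have "\<dots> \<le> (1 - \<alpha>) powr (real N / real L - 1)"
    using e a by (intro powr_mono') auto
  also have "\<dots> = (1 - \<alpha>) powr (real N / real L) / (1 - \<alpha>)"
    using a by (simp add: powr_diff)
  also have "\<dots> \<le> (1 - \<alpha>) powr (real N / real L) / (1 / 2)"
    using a by (intro divide_left_mono) auto
  also have "(1 - \<alpha>) powr (real N / real L) = ((1 - \<alpha>) powr (1 / real L)) ^ N"
    using a by (simp add: powr_realpow[symmetric] powr_powr)
  finally show ?thesis by simp
qed

text \<open>These are the push-sum weights \<open>\<rho>\<close> of the algorithm, which start at
  1.\<close>

definition mass :: "nat \<Rightarrow> nat \<Rightarrow> real" where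
  "mass t i = (\<Sum>j<m. P t 0 i j)"

lemma mass_nonneg: "i < m \<Longrightarrow> 0 \<le> mass t i"
  by (auto simp: mass_def intro!: sum_nonneg P_nonneg)

lemma mass_total: "(\<Sum>i<m. mass t i) = real m"
proof -
  have "(\<Sum>i<m. mass t i) = (\<Sum>j<m. \<Sum>i<m. P t 0 i j)"
    unfolding mass_def by (rule sum.swap)
  then show ?thesis by (simp add: P_col)
qed

lemma mass_comp:
  assumes "i < m" shows "mass (M + s) i = (\<Sum>k<m. P M s i k * mass s k)"
  using assms P_comp[of i M s 0]
  by (simp add: mass_def sum_distrib_left, subst sum.swap, simp)

lemma mass_0: "i < m \<Longrightarrow> mass 0 i = 1"
  by (simp add: mass_def)

lemma mass_Suc: "mass (Suc t) i = (\<Sum>k<m. W t i k * mass t k)"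
  by (simp add: mass_def sum_distrib_left, subst sum.swap, simp)

text \<open>\<open>mass (M + s)\<close> is \<open>P M s\<close> applied to \<open>mass s\<close>,
  whose total is \<open>m\<close>. Hence \<open>mass (M + s) i / m\<close> is a weighted average of
  row \<open>i\<close> of \<open>P M s\<close> and lies within the spread of that row.\<close>

lemma P_near_mass:
  assumes gap: "\<And>j l. j < m \<Longrightarrow> l < m \<Longrightarrow> P M s i j - P M s i l \<le> c" and ij: "i < m" "j < m"
  shows "\<bar>P M s i j - mass (M + s) i / real m\<bar> \<le> c"
proof -
  have m: "real m > 0" using ij by simp
  have "real m * P M s i j - mass (M + s) i = (\<Sum>k<m. (P M s i j - P M s i k) * mass s k)"
    using mass_comp[OF ij(1)] mass_total
    by (simp add: left_diff_distrib sum_subtractf sum_distrib_left[symmetric])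
  then have "\<bar>real m * P M s i j - mass (M + s) i\<bar> \<le> (\<Sum>k<m. \<bar>(P M s i j - P M s i k) * mass s k\<bar>)"
    using sum_abs by metis
  also have "\<dots> \<le> (\<Sum>k<m. c * mass s k)"
  proof (intro sum_mono)
    fix k assume k: "k \<in> {..<m}"
    then have "\<bar>P M s i j - P M s i k\<bar> \<le> c" using gap[of j k] gap[of k j] ij by auto
    then show "\<bar>(P M s i j - P M s i k) * mass s k\<bar> \<le> c * mass s k"
      using mass_nonneg[of k s] k by (simp add: abs_mult mult_right_mono)
  qed
  also have "\<dots> = real m * c" by (simp add: sum_distrib_left[symmetric] mass_total)
  finally have "\<bar>real m * P M s i j - mass (M + s) i\<bar> / real m \<le> c"
    using m by (simp add: field_simps)
  also have "\<bar>real m * P M s i j - mass (M + s) i\<bar> / real m = \<bar>(real m * P M s i j - mass (M + s) i) / real m\<bar>"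
    using m by simp
  also have "(real m * P M s i j - mass (M + s) i) / real m = P M s i j - mass (M + s) i / real m"
    using m by (simp add: field_simps)
  finally show ?thesis .
qed

section \<open>Push-sum recursion with additive perturbations\<close>

context
  fixes \<theta> u \<epsilon> :: "nat \<Rightarrow> nat \<Rightarrow> 'a::real_normed_vector"
  assumes u_upd: "\<And>i t. i < m \<Longrightarrow> u i (Suc t) = (\<Sum>j<m. W t i j *\<^sub>R \<theta> j t)"
    and \<theta>_0: "\<And>i. i < m \<Longrightarrow> \<theta> i 0 = \<epsilon> i 0"
    and \<theta>_Suc: "\<And>i t. i < m \<Longrightarrow> \<theta> i (Suc t) = u i (Suc t) + \<epsilon> i (Suc t)"
begin

text \<open>By linearity, a perturbation injected at time \<open>s\<close> has passed through
  \<open>W[s], ..., W[t]\<close>. Initial values count as the perturbation at time 0.\<close>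

lemma u_unroll: "i < m \<Longrightarrow> u i (Suc t) = (\<Sum>s\<le>t. \<Sum>j<m. P (Suc t - s) s i j *\<^sub>R \<epsilon> j s)"
proof -
  have id: "(\<Sum>j<m. P 0 s i j *\<^sub>R \<epsilon> j s) = \<epsilon> i s" if "i < m" for i s
  proof -
    have "(\<Sum>j<m. P 0 s i j *\<^sub>R \<epsilon> j s) = (\<Sum>j<m. if i = j then \<epsilon> j s else 0)"
      by (intro sum.cong) auto
    then show ?thesis using that by simp
  qed
  \<comment> \<open>Conditional on the formula for \<open>\<theta>\<close> at the same time, so that
    it serves both the induction for \<open>\<theta>\<close> and the conclusion for
    \<open>u\<close>.\<close>
  have step: "u i (Suc t) = (\<Sum>s\<le>t. \<Sum>j<m. P (Suc t - s) s i j *\<^sub>R \<epsilon> j s)"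
    if "i < m" and IH: "\<And>i. i < m \<Longrightarrow> \<theta> i t = (\<Sum>s\<le>t. \<Sum>j<m. P (t - s) s i j *\<^sub>R \<epsilon> j s)" for i t
  proof -
    have "u i (Suc t) = (\<Sum>k<m. \<Sum>s\<le>t. \<Sum>j<m. (W t i k * P (t - s) s k j) *\<^sub>R \<epsilon> j s)"
      using u_upd[OF that(1)] IH by (simp add: scaleR_sum_right)
    also have "\<dots> = (\<Sum>s\<le>t. \<Sum>k<m. \<Sum>j<m. (W t i k * P (t - s) s k j) *\<^sub>R \<epsilon> j s)"
      by (rule sum.swap)
    also have "\<dots> = (\<Sum>s\<le>t. \<Sum>j<m. \<Sum>k<m. (W t i k * P (t - s) s k j) *\<^sub>R \<epsilon> j s)"
      by (intro sum.cong refl sum.swap)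
    also have "\<dots> = (\<Sum>s\<le>t. \<Sum>j<m. P (Suc t - s) s i j *\<^sub>R \<epsilon> j s)"
      by (intro sum.cong refl) (simp add: Suc_diff_le scaleR_sum_left)
    finally show ?thesis .
  qed
  have all: "i < m \<Longrightarrow> \<theta> i t = (\<Sum>s\<le>t. \<Sum>j<m. P (t - s) s i j *\<^sub>R \<epsilon> j s)" for i t
  proof (induction t arbitrary: i)
    case 0
    then show ?case using \<theta>_0 id by simp
  next
    case (Suc t)
    then show ?case using \<theta>_Suc step[OF Suc.prems Suc.IH] id by simp
  qed
  show "i < m \<Longrightarrow> u i (Suc t) = (\<Sum>s\<le>t. \<Sum>j<m. P (Suc t - s) s i j *\<^sub>R \<epsilon> j s)"
    by (rule step[OF _ all])
qed

lemma u_total: "(\<Sum>i<m. u i (Suc t)) = (\<Sum>i<m. \<theta> i t)"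
proof -
  have "(\<Sum>i<m. u i (Suc t)) = (\<Sum>j<m. \<Sum>i<m. W t i j *\<^sub>R \<theta> j t)"
    using u_upd by (simp, subst sum.swap, simp)
  then show ?thesis by (simp add: scaleR_sum_left[symmetric] W_col)
qed

lemma \<theta>_total: "(\<Sum>i<m. \<theta> i t) = (\<Sum>s\<le>t. \<Sum>j<m. \<epsilon> j s)"
  by (induction t) (simp_all add: \<theta>_0 \<theta>_Suc sum.distrib u_total)

text \<open>Subtracting the share \<open>\<rho> / m\<close> of the total of \<open>\<theta>\<close>
  turns each coefficient of the unrolled \<open>u\<close> into a deviation of \<open>P\<close> from
  the normalised mass, geometrically small by \<open>P_near_mass\<close>. Dividing by the mass costs
  at most \<open>1 / \<delta>\<close>.\<close>

lemma consensus:
  assumes gap: "\<And>N s i j l. i < m \<Longrightarrow> j < m \<Longrightarrow> l < m \<Longrightarrow> P N s i j - P N s i l \<le> C * \<eta> ^ N"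
    and \<delta>: "0 < \<delta>" "\<delta> \<le> mass (Suc t) i" and i: "i < m" and C: "0 \<le> C" "0 \<le> \<eta>"
  shows "norm ((1 / mass (Suc t) i) *\<^sub>R u i (Suc t) - (1 / real m) *\<^sub>R (\<Sum>j<m. \<theta> j t))
    \<le> C / \<delta> * (\<Sum>s\<le>t. \<eta> ^ (Suc t - s) * (\<Sum>j<m. norm (\<epsilon> j s)))"
proof -
  define \<rho> where "\<rho> = mass (Suc t) i"
  have r: "\<rho> > 0" using \<delta> by (simp add: \<rho>_def)
  let ?S = "\<Sum>s\<le>t. \<eta> ^ (Suc t - s) * (\<Sum>j<m. norm (\<epsilon> j s))"
  have S0: "0 \<le> ?S" using C by (intro sum_nonneg mult_nonneg_nonneg) auto
  have eq: "u i (Suc t) - (\<rho> / real m) *\<^sub>R (\<Sum>j<m. \<theta> j t)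
      = (\<Sum>s\<le>t. \<Sum>j<m. (P (Suc t - s) s i j - \<rho> / real m) *\<^sub>R \<epsilon> j s)"
    by (simp only: u_unroll[OF i] \<theta>_total scaleR_sum_right sum_subtractf scaleR_diff_left)
  have "norm (u i (Suc t) - (\<rho> / real m) *\<^sub>R (\<Sum>j<m. \<theta> j t))
      \<le> (\<Sum>s\<le>t. \<Sum>j<m. (C * \<eta> ^ (Suc t - s)) * norm (\<epsilon> j s))"
    unfolding eq
  proof (intro order_trans[OF norm_sum] sum_mono)
    fix s j assume s: "s \<in> {..t}" and j: "j \<in> {..<m}"
    \<comment> \<open>For every \<open>s \<le> t\<close> this is the mass at time
      \<open>Suc t\<close>, so a single \<open>\<rho>\<close> works for all injection times.\<close>
    have "\<bar>P (Suc t - s) s i j - mass (Suc t - s + s) i / real m\<bar> \<le> C * \<eta> ^ (Suc t - s)"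
      by (rule P_near_mass) (use gap i j in auto)
    then have "\<bar>P (Suc t - s) s i j - \<rho> / real m\<bar> \<le> C * \<eta> ^ (Suc t - s)"
      using s by (simp add: \<rho>_def)
    then show "norm ((P (Suc t - s) s i j - \<rho> / real m) *\<^sub>R \<epsilon> j s) \<le> C * \<eta> ^ (Suc t - s) * norm (\<epsilon> j s)"
      by (simp add: mult_right_mono)
  qed
  also have "\<dots> = C * ?S" by (simp add: sum_distrib_left mult.assoc)
  finally have main: "norm (u i (Suc t) - (\<rho> / real m) *\<^sub>R (\<Sum>j<m. \<theta> j t)) \<le> C * ?S" .
  have "(1 / \<rho>) *\<^sub>R u i (Suc t) - (1 / real m) *\<^sub>R (\<Sum>j<m. \<theta> j t)
      = (1 / \<rho>) *\<^sub>R (u i (Suc t) - (\<rho> / real m) *\<^sub>R (\<Sum>j<m. \<theta> j t))"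
    using r by (simp add: scaleR_diff_right)
  then have "norm ((1 / \<rho>) *\<^sub>R u i (Suc t) - (1 / real m) *\<^sub>R (\<Sum>j<m. \<theta> j t))
      = norm (u i (Suc t) - (\<rho> / real m) *\<^sub>R (\<Sum>j<m. \<theta> j t)) / \<rho>"
    using r by simp
  also have "\<dots> \<le> (C * ?S) / \<delta>"
    using main r \<delta> C S0 by (intro frac_le) (auto simp: \<rho>_def)
  finally show ?thesis by (simp add: \<rho>_def)
qed

end

end

subsection \<open>Positivity of weight products over uniformly strongly connected graphs\<close>

lemma Wmat_nonneg: "0 \<le> Wmat m E t i j"
  by (simp add: Wmat_def)

lemma finite_out_nbrs: "finite (out_nbrs m E t i)"
  by (simp add: out_nbrs_def)

lemma outdeg_bounds:
  assumes "i < m" shows "0 < outdeg m E t i" "outdeg m E t i \<le> m"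
proof -
  show "0 < outdeg m E t i"
    using finite_out_nbrs[of m E t i] by (auto simp: outdeg_def card_gt_0_iff out_nbrs_def)
  have "card (out_nbrs m E t i) \<le> card {..<m}"
    using assms by (intro card_mono) (auto simp: out_nbrs_def)
  then show "outdeg m E t i \<le> m" by (simp add: outdeg_def)
qed

lemma Wmat_col:
  assumes "j < m" shows "(\<Sum>i<m. Wmat m E t i j) = 1"
proof -
  have "(\<Sum>i<m. Wmat m E t i j) = (\<Sum>i\<in>out_nbrs m E t j. 1 / real (outdeg m E t j))"
    using assms by (intro sum.mono_neutral_cong_right)
      (auto simp: Wmat_def in_nbrs_def out_nbrs_def)
  also have "\<dots> = 1" using outdeg_bounds[OF assms, of E t] by (simp add: outdeg_def)
  finally show ?thesis .
qed

text \<open>An agent splits its mass equally among at most \<open>m\<close> receivers, itself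
  included.\<close>

lemma Wmat_ge:
  assumes "j < m" "i = j \<or> (j, i) \<in> E t" shows "1 / real m \<le> Wmat m E t i j"
  using assms outdeg_bounds[OF assms(1), of E t]
  by (auto simp: Wmat_def in_nbrs_def intro!: divide_left_mono)

global_interpretation Wm: column_stochastic m "Wmat m E" for m E
  defines Wprod = Wm.P and Wmass = Wm.mass
  by unfold_locales (simp_all add: Wmat_nonneg Wmat_col)

lemma Wprod_step_ge:
  assumes "k < m" "i < m" "j < m" "i = k \<or> (k, i) \<in> E (s + N)" "(1 / real m) ^ N \<le> Wprod m E N s k j"
  shows "(1 / real m) ^ Suc N \<le> Wprod m E (Suc N) s i j"
proof -
  have "(1 / real m) ^ Suc N \<le> Wmat m E (s + N) i k * Wprod m E N s k j"
    unfolding power_Suc using assms by (intro mult_mono Wmat_ge Wmat_nonneg) auto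
  also have "\<dots> \<le> (\<Sum>k<m. Wmat m E (s + N) i k * Wprod m E N s k j)"
    using assms by (intro member_le_sum[where f="\<lambda>k. Wmat m E (s + N) i k * Wprod m E N s k j"])
      (auto intro!: mult_nonneg_nonneg Wmat_nonneg Wm.P_nonneg)
  finally show ?thesis by simp
qed

lemma Wprod_diag_ge: "i < m \<Longrightarrow> (1 / real m) ^ N \<le> Wprod m E N s i i"
proof (induction N)
  case (Suc N) then show ?case using Wprod_step_ge by blast
qed simp

text \<open>The threshold is the mass guaranteed by one walk from \<open>j\<close> during steps
  \<open>s\<close> to \<open>t - 1\<close>: each edge or self-loop passes on at least the fraction
  \<open>1 / m\<close>.\<close>

definition reached :: "nat \<Rightarrow> (nat \<Rightarrow> (nat \<times> nat) set) \<Rightarrow> nat \<Rightarrow> nat \<Rightarrow> nat \<Rightarrow> nat set" where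
  "reached m E s j t = {i. i < m \<and> (1 / real m) ^ (t - s) \<le> Wprod m E (t - s) s i j}"

lemma reached_step:
  assumes "s \<le> t" "j < m" "k \<in> reached m E s j t" "i < m" "i = k \<or> (k, i) \<in> E t"
  shows "i \<in> reached m E s j (Suc t)"
  using assms Wprod_step_ge[of k m i j E s "t - s"] by (simp add: reached_def Suc_diff_le)

lemma reached_mono:
  assumes "s \<le> t" "t \<le> t'" "j < m" shows "reached m E s j t \<subseteq> reached m E s j t'"
  using assms(2)
proof (induction t' rule: dec_induct)
  case (step t')
  \<comment> \<open>Self-loops keep every reached agent reached.\<close>
  have "reached m E s j t' \<subseteq> reached m E s j (Suc t')"
    using assms step reached_step[of s t' j m] by (auto simp: reached_def)
  then show ?case using step by blast
qed simp

lemma reached_start: "j < m \<Longrightarrow> j \<in> reached m E s j s"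
  by (simp add: reached_def)

text \<open>If a block of \<open>Bc\<close> steps adds no agent, monotonicity freezes the set
  throughout the block, so it is closed under every edge occurring there. Strong connectivity of the
  union then spreads it from \<open>j\<close> to all agents.\<close>

lemma reached_block:
  assumes conn: "B_connected m E Bc" and E: "\<forall>t. E t \<subseteq> {..<m} \<times> {..<m}"
    and s: "s \<le> k * Bc" and j: "j < m"
    and const: "reached m E s j ((k + 1) * Bc) = reached m E s j (k * Bc)"
  shows "reached m E s j (k * Bc) = {..<m}"
proof -
  let ?R = "reached m E s j (k * Bc)"
  let ?U = "\<Union>l\<in>{k * Bc .. (k + 1) * Bc - 1}. E l"
  have Bc: "Bc > 0" using conn by (simp add: B_connected_def)
  have closed: "b \<in> ?R" if "(a, b) \<in> ?U" "a \<in> ?R" for a b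
  proof -
    from that obtain l where l: "k * Bc \<le> l" "l \<le> (k + 1) * Bc - 1" "(a, b) \<in> E l" by auto
    have l2: "Suc l \<le> (k + 1) * Bc" using l(2) Bc by (cases "(k + 1) * Bc") auto
    have "a \<in> reached m E s j l" using that(2) reached_mono[OF s l(1) j] by blast
    then have "b \<in> reached m E s j (Suc l)"
      using l E s j by (intro reached_step[of s l j m a]) auto
    then show ?thesis using reached_mono[of s "Suc l" "(k + 1) * Bc" j m E] l l2 s j const by auto
  qed
  have "i \<in> ?R" if "i < m" for i
  proof -
    have "(j, i) \<in> ?U\<^sup>*" using conn that j by (auto simp: B_connected_def strongly_connected_on_def)
    then show ?thesis
    proof (induction rule: rtrancl_induct)
      case base
      show ?case using reached_start[OF j] reached_mono[OF order_refl s j] by blast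
    next
      case (step y z)
      then show ?case using closed by blast
    qed
  qed
  then show ?thesis by (auto simp: reached_def)
qed

text \<open>The agent \<open>j\<close> is present at the start, and by \<open>reached_block\<close>
  every further block adds an agent until all are reached.\<close>

lemma card_reached:
  assumes conn: "B_connected m E Bc" and E: "\<forall>t. E t \<subseteq> {..<m} \<times> {..<m}"
    and s: "s \<le> k0 * Bc" and j: "j < m"
  shows "min m (Suc k) \<le> card (reached m E s j ((k0 + k) * Bc))"
proof (induction k)
  have fin: "finite (reached m E s j t)" for t by (simp add: reached_def)
  case 0
  have "j \<in> reached m E s j (k0 * Bc)" using reached_start[OF j] reached_mono[OF order_refl s j] by blast
  then have "0 < card (reached m E s j (k0 * Bc))" using fin by (auto simp: card_gt_0_iff)
  then show ?case by simp
next
  case (Suc k)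
  have fin: "finite (reached m E s j t)" for t by (simp add: reached_def)
  have s': "s \<le> (k0 + k) * Bc" using s by (simp add: algebra_simps)
  let ?R = "reached m E s j ((k0 + k) * Bc)" and ?R' = "reached m E s j ((k0 + k + 1) * Bc)"
  have sub: "?R \<subseteq> ?R'" using s' j by (intro reached_mono) auto
  show ?case
  proof (cases "?R' = ?R")
    case True
    then have "?R = {..<m}" using reached_block[OF conn E s' j] by simp
    then show ?thesis using True by simp
  next
    case False
    then have "card ?R < card ?R'" using sub fin by (intro psubset_card_mono) auto
    then show ?thesis using Suc by simp
  qed
qed

lemma Wprod_window_ge:
  assumes conn: "B_connected m E Bc" and E: "\<forall>t. E t \<subseteq> {..<m} \<times> {..<m}"
    and ij: "i < m" "j < m"
  shows "1 / real m ^ (m * Bc) \<le> Wprod m E (m * Bc) s i j"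
proof -
  have Bc: "Bc > 0" using conn by (simp add: B_connected_def)
  \<comment> \<open>The first block boundary at or after \<open>s\<close> is \<open>k0 * Bc\<close>.
    Rounding up loses at most \<open>Bc - 1\<close> steps, so the \<open>m - 1\<close> blocks that
    follow still end within \<open>m * Bc\<close> steps of \<open>s\<close>.\<close>
  define k0 where "k0 = (s + Bc - 1) div Bc"
  have k1: "s \<le> k0 * Bc"
    using dividend_less_div_times[OF Bc, of "s + Bc - 1"] Bc by (simp add: k0_def)
  have "k0 * Bc \<le> s + Bc - 1" by (simp add: k0_def)
  moreover have "(m - 1) * Bc + Bc = m * Bc" using ij by (cases m) auto
  ultimately have k2: "(k0 + (m - 1)) * Bc \<le> s + m * Bc" unfolding add_mult_distrib by linarith
  have "m \<le> card (reached m E s j ((k0 + (m - 1)) * Bc))"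
    using card_reached[OF conn E k1 ij(2), of "m - 1"] ij by simp
  moreover have "reached m E s j ((k0 + (m - 1)) * Bc) \<subseteq> {..<m}" by (auto simp: reached_def)
  ultimately have "reached m E s j ((k0 + (m - 1)) * Bc) = {..<m}"
    by (metis card_lessThan card_seteq finite_lessThan)
  moreover have "reached m E s j ((k0 + (m - 1)) * Bc) \<subseteq> reached m E s j (s + m * Bc)"
    using k1 k2 ij by (intro reached_mono order_trans[OF k1]) auto
  ultimately have "i \<in> reached m E s j (s + m * Bc)" using ij by blast
  then show ?thesis by (simp add: reached_def power_one_over)
qed

text \<open>Once a full window has passed, its last \<open>m * Bc\<close> steps redistribute the
  total mass \<open>m \<ge> 1\<close> with every entry above the bound. Earlier, the share an agent
  has kept through its self-loops suffices.\<close>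

lemma Wmass_ge:
  assumes conn: "B_connected m E Bc" and E: "\<forall>t. E t \<subseteq> {..<m} \<times> {..<m}" and i: "i < m"
  shows "1 / real m ^ (m * Bc) \<le> Wmass m E t i"
proof (cases "m * Bc \<le> t")
  case True
  then obtain s where t: "t = m * Bc + s" using le_Suc_ex by blast
  let ?a = "1 / real m ^ (m * Bc)"
  have "?a \<le> ?a * real m" using i mult_left_mono[of 1 "real m" ?a] by simp
  also have "\<dots> = (\<Sum>k<m. ?a * Wmass m E s k)"
    by (simp only: sum_distrib_left[symmetric] Wm.mass_total)
  also have "\<dots> \<le> (\<Sum>k<m. Wprod m E (m * Bc) s i k * Wmass m E s k)"
    using i by (intro sum_mono mult_right_mono Wprod_window_ge[OF conn E] Wm.mass_nonneg) auto
  also have "\<dots> = Wmass m E t i" using Wm.mass_comp[OF i] t by simp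
  finally show ?thesis .
next
  case False
  have "1 / real m ^ (m * Bc) = (1 / real m) ^ (m * Bc)" by (simp add: power_one_over)
  also have "\<dots> \<le> (1 / real m) ^ t" using False i by (intro power_decreasing) auto
  also have "\<dots> \<le> Wprod m E t 0 i i" by (rule Wprod_diag_ge[OF i])
  also have "\<dots> \<le> Wmass m E t i"
    unfolding Wm.mass_def using i by (intro member_le_sum) (auto intro: Wm.P_nonneg)
  finally show ?thesis .
qed

text \<open>The product \<open>W[t] ... W[0]\<close> has \<open>t + 1\<close> factors, hence the
  shifted index.\<close>

lemma Wprod_one_eq_mass: "i < m \<Longrightarrow> Wprod_one m E t i = Wmass m E (Suc t) i"
proof (induction t arbitrary: i)
  case 0 then show ?case by (simp add: Wm.mass_Suc Wm.mass_0)
next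
  case (Suc t) then show ?case by (simp add: Wm.mass_Suc[where t="Suc t"])
qed

lemma delta_const_bounds:
  assumes conn: "B_connected m E Bc" and E: "\<forall>t. E t \<subseteq> {..<m} \<times> {..<m}" and m: "m \<ge> 1"
  shows "0 < delta_const m E" and "i < m \<Longrightarrow> delta_const m E \<le> Wmass m E (Suc t) i"
proof -
  let ?a = "1 / real m ^ (m * Bc)"
  let ?M = "\<lambda>t. Min ((\<lambda>i. Wprod_one m E t i) ` {..<m})"
  have ne: "(\<lambda>i. Wprod_one m E t i) ` {..<m} \<noteq> {}" for t using m by (auto simp: lessThan_empty_iff)
  \<comment> \<open>This uniform bound serves twice: it makes the infimum positive, and as
    boundedness below it lets the infimum be compared with its members.\<close>
  have lo: "?a \<le> ?M t" for t
    using ne by (auto simp: Wprod_one_eq_mass Wmass_ge[OF conn E])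
  have "?a \<le> delta_const m E"
    unfolding delta_const_def using lo by (intro cINF_greatest) auto
  then show "0 < delta_const m E" using m by (auto intro: less_le_trans[rotated])
  assume i: "i < m"
  have "delta_const m E \<le> ?M t"
    unfolding delta_const_def using lo by (intro cINF_lower bdd_belowI2) auto
  also have "\<dots> \<le> Wprod_one m E t i" using i by (intro Min_le) auto
  finally show "delta_const m E \<le> Wmass m E (Suc t) i" using i by (simp add: Wprod_one_eq_mass)
qed

text \<open>For \<open>m = 1\<close> the base of the power is 0 and so is \<open>eta_const\<close>,
  which is why the lower bound is not strict.\<close>

lemma eta_const_bounds:
  assumes "m \<ge> 1" "Bc > 0" shows "0 \<le> eta_const m Bc" "eta_const m Bc < 1"
proof -
  have "0 < 1 / real m ^ (m * Bc)" "1 / real m ^ (m * Bc) \<le> 1" using assms by auto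
  then have "(1 - 1 / real m ^ (m * Bc)) powr (1 / real (m * Bc)) < 1 powr (1 / real (m * Bc))"
    using assms by (intro powr_less_mono2) auto
  then show "0 \<le> eta_const m Bc" "eta_const m Bc < 1" by (simp_all add: eta_const_def)
qed

lemma Wprod_row_gap:
  assumes conn: "B_connected m E Bc" and E: "\<forall>t. E t \<subseteq> {..<m} \<times> {..<m}"
    and ijl: "i < m" "j < m" "l < m"
  shows "Wprod m E N s i j - Wprod m E N s i l \<le> 2 * eta_const m Bc ^ N"
proof -
  have Bc: "Bc > 0" using conn by (simp add: B_connected_def)
  have half: "1 / real m ^ (m * Bc) \<le> 1 / 2" if "m \<ge> 2"
  proof -
    have "real m ^ 1 \<le> real m ^ (m * Bc)" using that Bc by (intro power_increasing) auto
    then have "2 \<le> real m ^ (m * Bc)" using that unfolding power_one_right by linarith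
    then show ?thesis by (intro divide_left_mono) auto
  qed
  show ?thesis unfolding eta_const_def
    by (rule Wm.P_row_gap) (use ijl Bc half Wprod_window_ge[OF conn E] in auto)
qed

subsection \<open>Dual descent estimates and primal averaging\<close>

lemma norm_le_l1norm: "norm v \<le> l1norm v"
  unfolding l1norm_def by (rule norm_le_l1_cart)

text \<open>Each step uses \<open>ln y \<le> y - 1\<close> at \<open>y = T / (T + 1)\<close>, which
  bounds the new term by the increment of \<open>ln\<close>.\<close>

lemma sum_inverse_le_ln: "T \<ge> 1 \<Longrightarrow> (\<Sum>s=1..T. 1 / real s) \<le> 1 + ln (real T)"
proof (induction T rule: dec_induct)
  case (step T)
  have "ln (real T / real (Suc T)) \<le> real T / real (Suc T) - 1"
    using step by (intro ln_le_minus_one) auto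
  also have "\<dots> = - (1 / real (Suc T))" by (simp add: field_simps)
  finally have "1 / real (Suc T) \<le> ln (real (Suc T)) - ln (real T)"
    using step by (simp add: ln_div)
  then show ?case using step by simp
qed simp

text \<open>The inner sums \<open>c\<^sub>t\<close> satisfy \<open>c\<^bsub>t+1\<^esub> = \<eta> (c\<^sub>t + e\<^sub>t)\<close>, which makes the double sum telescope.\<close>

lemma geometric_convolution_eq:
  "(1 - \<eta>) * (\<Sum>t=1..T. \<Sum>s<t. \<eta> ^ (t - s) * e s) + \<eta> * (\<Sum>s<T. \<eta> ^ (T - s) * e s)
    = \<eta> * (\<Sum>s<T. e s)" for \<eta> :: real
proof (induction T)
  case (Suc T)
  have "(\<Sum>s<Suc T. \<eta> ^ (Suc T - s) * e s) = \<eta> * ((\<Sum>s<T. \<eta> ^ (T - s) * e s) + e T)"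
    by (simp add: Suc_diff_le distrib_left sum_distrib_left mult.assoc)
  moreover have "(\<Sum>t=1..Suc T. \<Sum>s<t. \<eta> ^ (t - s) * e s)
      = (\<Sum>t=1..T. \<Sum>s<t. \<eta> ^ (t - s) * e s) + (\<Sum>s<Suc T. \<eta> ^ (Suc T - s) * e s)"
    by (subst sum.cl_ivl_Suc) simp
  moreover have "(\<Sum>s<Suc T. e s) = (\<Sum>s<T. e s) + e T" by simp
  ultimately show ?case using Suc by (simp only:) (simp add: distrib_left left_diff_distrib)
qed simp

text \<open>The boundary term of the telescoped identity is nonnegative and is dropped. Time 0 is
  bounded separately by \<open>\<Theta>\<close>, the later terms by a harmonic sum.\<close>

lemma geometric_convolution_le:
  fixes \<eta> c \<Theta> :: real
  assumes \<eta>: "0 \<le> \<eta>" "\<eta> < 1" and e: "\<And>s. 0 \<le> e s" "e 0 \<le> \<Theta>" "\<And>s. s \<ge> 1 \<Longrightarrow> e s \<le> c / real s"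
    and T: "T \<ge> 1"
  shows "(\<Sum>t=1..T. \<Sum>s<t. \<eta> ^ (t - s) * e s)
    \<le> \<eta> / (1 - \<eta>) * \<Theta> + c / (1 - \<eta>) * (1 + ln (real T))"
proof -
  let ?S = "\<Sum>t=1..T. \<Sum>s<t. \<eta> ^ (t - s) * e s"
  have c: "0 \<le> c" using e(1)[of 1] e(3)[of 1] by simp
  have l0: "0 \<le> c * (1 + ln (real T))" using c T by simp
  have "(\<Sum>s<T. e s) = e 0 + (\<Sum>s=1..<T. e s)"
    using T sum.atLeast_Suc_lessThan[of 0 T e] by (simp add: atLeast0LessThan)
  also have "\<dots> \<le> \<Theta> + (\<Sum>s=1..T. c * (1 / real s))"
  proof (intro add_mono e(2))
    have "(\<Sum>s=1..<T. e s) \<le> (\<Sum>s=1..T. e s)" using e(1) by (intro sum_mono2) auto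
    also have "\<dots> \<le> (\<Sum>s=1..T. c * (1 / real s))" using e(3) by (intro sum_mono) auto
    finally show "(\<Sum>s=1..<T. e s) \<le> (\<Sum>s=1..T. c * (1 / real s))" .
  qed
  also have "\<dots> \<le> \<Theta> + c * (1 + ln (real T))"
    unfolding sum_distrib_left[symmetric] using sum_inverse_le_ln[OF T] c by (intro add_mono mult_left_mono) auto
  finally have E: "(\<Sum>s<T. e s) \<le> \<Theta> + c * (1 + ln (real T))" .
  have "0 \<le> \<eta> * (\<Sum>s<T. \<eta> ^ (T - s) * e s)" using \<eta> e(1) by (intro mult_nonneg_nonneg sum_nonneg) auto
  then have "(1 - \<eta>) * ?S \<le> \<eta> * (\<Sum>s<T. e s)"
    using geometric_convolution_eq[of \<eta> e T] by linarith
  also have "\<dots> \<le> \<eta> * (\<Theta> + c * (1 + ln (real T)))" using E \<eta> by (intro mult_left_mono) auto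
  \<comment> \<open>The factor \<open>\<eta>\<close> is kept on \<open>\<Theta>\<close> and bounded
    by 1 on the logarithmic term only, to reach the stated shape.\<close>
  also have "\<dots> \<le> \<eta> * \<Theta> + c * (1 + ln (real T))"
    using l0 \<eta> mult_right_mono[of \<eta> 1 "c * (1 + ln (real T))"] by (simp add: distrib_left)
  finally have "?S \<le> (\<eta> * \<Theta> + c * (1 + ln (real T))) / (1 - \<eta>)"
    using \<eta> by (simp add: pos_le_divide_eq mult.commute)
  then show ?thesis by (simp add: add_divide_distrib)
qed

text \<open>The products \<open>T * (T + 1)\<close> and \<open>T * (T - 1)\<close> of weight and
  time differ by \<open>2 * T\<close>, so in the step \<open>a T\<close> collects the coefficient
  \<open>T * (M / q - g)\<close>, nonpositive since \<open>M \<le> q * g\<close>.\<close>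

lemma weighted_telescope:
  fixes a :: "nat \<Rightarrow> real"
  assumes "\<And>t. 0 \<le> a t" "q > 0" "M \<le> q * g"
  shows "(\<Sum>t=1..T. real (t - 1) * (M * real t / (2 * q) * (a (t - 1) - a t) - g * a (t - 1)))
    \<le> - (real T * (real T - 1) * M / (2 * q) * a T)"
proof (induction T)
  case (Suc T)
  have "real T * a T * (M / q - g) \<le> 0"
    using assms by (intro mult_nonneg_nonpos mult_nonneg_nonneg) (auto simp: field_simps)
  then have "- (real T * (real T - 1) * M / (2 * q) * a T)
      + real T * (M * real (Suc T) / (2 * q) * (a T - a (Suc T)) - g * a T)
    \<le> - (real (Suc T) * (real (Suc T) - 1) * M / (2 * q) * a (Suc T))"
    using assms(2) by (simp add: field_simps)
  then show ?case using Suc by simp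
qed simp

lemma norm_sum_squared_le:
  fixes g :: "nat \<Rightarrow> 'a::real_inner"
  assumes "\<And>i. i < m \<Longrightarrow> norm (g i) \<le> C i"
  shows "(norm (\<Sum>i<m. g i))\<^sup>2 \<le> real m * (\<Sum>i<m. (C i)\<^sup>2)"
proof -
  have "norm (\<Sum>i<m. g i) \<le> (\<Sum>i<m. C i)"
    using assms by (intro order_trans[OF norm_sum] sum_mono) auto
  then have "(norm (\<Sum>i<m. g i))\<^sup>2 \<le> (\<Sum>i<m. C i)\<^sup>2" by (intro power_mono) auto
  also have "\<dots> \<le> real m * (\<Sum>i<m. (C i)\<^sup>2)"
    using sum_squared_le_sum_of_squares[of C "{..<m}"] by (simp add: mult.commute)
  finally show ?thesis .
qed

text \<open>Lagrangian minimality bounds the gap by multipliers times constraint differences.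
  Replacing each \<open>lam i\<close> by the common \<open>th\<close> costs the consensus error
  \<open>K\<close>; feasibility then removes \<open>hs\<close>, and the update turns the rest into a
  difference of squared norms plus a term of order \<open>\<beta>\<close>.\<close>

lemma dual_step_gap:
  fixes lam h hs :: "nat \<Rightarrow> 'a::real_inner" and fx fs \<gamma> G :: "nat \<Rightarrow> real"
  assumes m: "m > 0" and \<beta>: "\<beta> > 0"
    and opt: "\<And>i. i < m \<Longrightarrow> fx i + lam i \<bullet> h i \<le> fs i + lam i \<bullet> hs i"
    and feas: "(\<Sum>i<m. hs i) = 0"
    and upd: "th' = th + (\<beta> / real m) *\<^sub>R (\<Sum>i<m. h i - \<gamma> i *\<^sub>R lam i)"
    and \<gamma>: "\<And>i. i < m \<Longrightarrow> 0 \<le> \<gamma> i"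
    and h: "\<And>i. i < m \<Longrightarrow> norm (h i) \<le> G i" and hs: "\<And>i. i < m \<Longrightarrow> norm (hs i) \<le> G i"
    and lam: "\<And>i. i < m \<Longrightarrow> norm (lam i) \<le> D" and th: "norm th \<le> D"
    and K: "\<And>i. i < m \<Longrightarrow> norm (lam i - th) \<le> K"
  shows "(\<Sum>i<m. fx i) - (\<Sum>i<m. fs i) \<le> 2 * K * (\<Sum>i<m. G i + \<gamma> i * D)
    + (real m / (2 * \<beta>) * ((norm th)\<^sup>2 - (norm th')\<^sup>2) - (\<Sum>i<m. \<gamma> i) * (norm th)\<^sup>2)
    + \<beta> / 2 * (\<Sum>i<m. (G i + \<gamma> i * D)\<^sup>2)"
proof -
  define S where "S = (\<Sum>i<m. h i - \<gamma> i *\<^sub>R lam i)"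
  have err: "(lam i - th) \<bullet> (hs i - h i - \<gamma> i *\<^sub>R th) \<le> 2 * K * (G i + \<gamma> i * D)" if i: "i < m" for i
  proof -
    have "norm (hs i - h i - \<gamma> i *\<^sub>R th) \<le> norm (hs i) + norm (h i) + norm (\<gamma> i *\<^sub>R th)"
      by (meson norm_triangle_ineq4 order_trans add_right_mono)
    also have "\<dots> \<le> G i + G i + \<gamma> i * D"
      using h[OF i] hs[OF i] th \<gamma>[OF i] by (intro add_mono) (auto intro: mult_left_mono)
    also have "\<dots> \<le> 2 * (G i + \<gamma> i * D)"
      using \<gamma>[OF i] order_trans[OF norm_ge_zero th] by simp
    finally have n: "norm (hs i - h i - \<gamma> i *\<^sub>R th) \<le> 2 * (G i + \<gamma> i * D)" .
    have K0: "0 \<le> K" using K[OF i] norm_ge_zero order_trans by blast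
    have "(lam i - th) \<bullet> (hs i - h i - \<gamma> i *\<^sub>R th) \<le> norm (lam i - th) * norm (hs i - h i - \<gamma> i *\<^sub>R th)"
      by (rule norm_cauchy_schwarz)
    also have "\<dots> \<le> K * (2 * (G i + \<gamma> i * D))" using K[OF i] n K0 by (intro mult_mono) auto
    finally show ?thesis by (simp only: mult_ac)
  qed
  have "(\<Sum>i<m. fx i) - (\<Sum>i<m. fs i) = (\<Sum>i<m. fx i - fs i)" by (simp add: sum_subtractf)
  also have "\<dots> \<le> (\<Sum>i<m. lam i \<bullet> (hs i - h i))"
    using opt by (intro sum_mono) (auto simp: inner_diff_right algebra_simps)
  \<comment> \<open>The \<open>\<gamma> i\<close> terms are added and subtracted so that the dual
    gradient \<open>h i - \<gamma> i *\<^sub>R lam i\<close> appears; the damping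
    \<open>- \<gamma> i * (norm th)\<^sup>2\<close> remains.\<close>
  also have "\<dots> = (\<Sum>i<m. (lam i - th) \<bullet> (hs i - h i - \<gamma> i *\<^sub>R th)
      + (th \<bullet> hs i - th \<bullet> (h i - \<gamma> i *\<^sub>R lam i) - \<gamma> i * (norm th)\<^sup>2))"
    by (intro sum.cong refl)
      (simp add: inner_diff_left inner_diff_right algebra_simps power2_norm_eq_inner inner_commute)
  also have "\<dots> = (\<Sum>i<m. (lam i - th) \<bullet> (hs i - h i - \<gamma> i *\<^sub>R th))
      - th \<bullet> S - (\<Sum>i<m. \<gamma> i) * (norm th)\<^sup>2"
    unfolding sum.distrib sum_subtractf inner_sum_right[symmetric] sum_distrib_right[symmetric] feas
    by (simp add: S_def sum_subtractf)
  also have "\<dots> \<le> (\<Sum>i<m. 2 * K * (G i + \<gamma> i * D)) - th \<bullet> S - (\<Sum>i<m. \<gamma> i) * (norm th)\<^sup>2"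
    using sum_mono[of "{..<m}", OF err] by simp
  finally have 1: "(\<Sum>i<m. fx i) - (\<Sum>i<m. fs i)
      \<le> 2 * K * (\<Sum>i<m. G i + \<gamma> i * D) - th \<bullet> S - (\<Sum>i<m. \<gamma> i) * (norm th)\<^sup>2"
    by (simp add: sum_distrib_left)
  \<comment> \<open>Expanding the square of the ascent step expresses \<open>th \<bullet> S\<close>
    through the norms of \<open>th\<close>, \<open>th'\<close> and \<open>S\<close>.\<close>
  have "(norm th')\<^sup>2 = (norm th)\<^sup>2 + 2 * (\<beta> / real m) * (th \<bullet> S) + (\<beta> / real m)\<^sup>2 * (norm S)\<^sup>2"
    unfolding upd S_def[symmetric] power2_norm_eq_inner
    by (simp add: inner_add_left inner_add_right inner_commute power2_eq_square algebra_simps)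
  then have 2: "- (th \<bullet> S) = real m / (2 * \<beta>) * ((norm th)\<^sup>2 - (norm th')\<^sup>2) + \<beta> / (2 * real m) * (norm S)\<^sup>2"
    using m \<beta> by (simp add: field_simps power2_eq_square)
  have "(norm S)\<^sup>2 \<le> real m * (\<Sum>i<m. (G i + \<gamma> i * D)\<^sup>2)"
    unfolding S_def
  proof (rule norm_sum_squared_le)
    fix i assume i: "i < m"
    have "norm (h i - \<gamma> i *\<^sub>R lam i) \<le> norm (h i) + norm (\<gamma> i *\<^sub>R lam i)" by (rule norm_triangle_ineq4)
    also have "\<dots> \<le> G i + \<gamma> i * D" using h[OF i] lam[OF i] \<gamma>[OF i] by (auto intro!: add_mono mult_left_mono)
    finally show "norm (h i - \<gamma> i *\<^sub>R lam i) \<le> G i + \<gamma> i * D" .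
  qed
  then have "\<beta> / (2 * real m) * (norm S)\<^sup>2 \<le> \<beta> / (2 * real m) * (real m * (\<Sum>i<m. (G i + \<gamma> i * D)\<^sup>2))"
    using \<beta> by (intro mult_left_mono) auto
  also have "\<dots> = \<beta> / 2 * (\<Sum>i<m. (G i + \<gamma> i * D)\<^sup>2)" using m by simp
  finally show ?thesis using 1 2 by linarith
qed

section \<open>Primal averages with weights \<open>t - 1\<close>\<close>

lemma sum_pred_weights: "(\<Sum>t=1..T. real (t - 1)) = real T * (real T - 1) / 2"
  by (induction T) (auto simp: field_simps)

text \<open>The coefficient \<open>2 / real (Suc T)\<close> is the new weight \<open>T\<close>
  divided by the new total \<open>T * (T + 1) / 2\<close>.\<close>

lemma weighted_average_Suc:
  assumes "T \<ge> 2"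
  shows "(\<Sum>t=1..Suc T. real (t - 1) * z t) / (real (Suc T) * (real (Suc T) - 1) / 2)
    = (1 - 2 / real (Suc T)) * ((\<Sum>t=1..T. real (t - 1) * z t) / (real T * (real T - 1) / 2))
      + 2 / real (Suc T) * z (Suc T)"
proof -
  have "real T > 0" "real T - 1 > 0" using assms by auto
  then show ?thesis by (simp add: divide_simps)
qed

text \<open>Jensen's inequality, one convex combination per new iterate; the quadratic term has a
  favourable sign and is discarded.\<close>

lemma strongly_convex_average:
  assumes sc: "strongly_convex_Rn n \<tau> f" and \<tau>: "\<tau> \<ge> 0" and x: "\<And>t. t \<ge> 1 \<Longrightarrow> x t \<in> Rn n"
    and T: "T \<ge> 2"
  shows "f (\<lambda>k. (\<Sum>t=1..T. real (t - 1) * x t k) / (real T * (real T - 1) / 2))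
    \<le> (\<Sum>t=1..T. real (t - 1) * f (x t)) / (real T * (real T - 1) / 2)"
  using T
proof (induction T rule: dec_induct)
  case base
  \<comment> \<open>At \<open>T = 2\<close> the iterate at time 1 has weight 0, so the average is
    \<open>x 2\<close> itself.\<close>
  have "{1..2::nat} = {1, 2}" by auto
  then show ?case by simp
next
  case (step T)
  define a where "a = 2 / real (Suc T)"
  define y where "y = (\<lambda>k. (\<Sum>t=1..T. real (t - 1) * x t k) / (real T * (real T - 1) / 2))"
  have a: "0 \<le> a" "a \<le> 1" using step by (auto simp: a_def)
  have y: "y \<in> Rn n" unfolding Rn_def y_def
  proof (intro CollectI allI impI)
    fix k assume "n \<le> k"
    then have "(\<Sum>t=1..T. real (t - 1) * x t k) = 0" using x by (intro sum.neutral) (auto simp: Rn_def)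
    then show "(\<Sum>t=1..T. real (t - 1) * x t k) / (real T * (real T - 1) / 2) = 0" by simp
  qed
  have avg: "(\<lambda>k. (\<Sum>t=1..Suc T. real (t - 1) * x t k) / (real (Suc T) * (real (Suc T) - 1) / 2))
      = comb a (x (Suc T)) y"
    unfolding weighted_average_Suc[OF step(1)] comb_def a_def y_def by (simp only: add.commute)
  have "f (comb a (x (Suc T)) y) \<le> a * f (x (Suc T)) + (1 - a) * f y
      - \<tau> / 2 * a * (1 - a) * (enorm n (\<lambda>k. x (Suc T) k - y k))\<^sup>2"
    using sc x[of "Suc T"] y a by (auto simp: strongly_convex_Rn_def)
  also have "\<dots> \<le> a * f (x (Suc T)) + (1 - a) * f y" using \<tau> a by simp
  also have "\<dots> \<le> a * f (x (Suc T)) + (1 - a) * ((\<Sum>t=1..T. real (t - 1) * f (x t)) / (real T * (real T - 1) / 2))"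
    using step.IH a by (intro add_mono mult_left_mono) (auto simp: y_def)
  also have "\<dots> = (\<Sum>t=1..Suc T. real (t - 1) * f (x t)) / (real (Suc T) * (real (Suc T) - 1) / 2)"
    unfolding weighted_average_Suc[OF step(1)] a_def by (simp only: add.commute)
  finally show ?case unfolding avg .
qed

section \<open>Convergence bound for the averaged primal iterates\<close>

theorem theorem2:
  fixes m :: nat and n :: "nat \<Rightarrow> nat"
    and f :: "nat \<Rightarrow> (nat \<Rightarrow> real) \<Rightarrow> real" and X :: "nat \<Rightarrow> (nat \<Rightarrow> real) set"
    and A :: "nat \<Rightarrow> 'p::finite \<Rightarrow> nat \<Rightarrow> real" and b :: "nat \<Rightarrow> real^'p"
    and \<gamma> \<tau> G :: "nat \<Rightarrow> real"
    and E :: "nat \<Rightarrow> (nat \<times> nat) set" and Bc :: nat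
    and q D :: real
    and \<theta> u lam :: "nat \<Rightarrow> nat \<Rightarrow> real^'p" and \<rho> :: "nat \<Rightarrow> nat \<Rightarrow> real"
    and x :: "nat \<Rightarrow> nat \<Rightarrow> (nat \<Rightarrow> real)"
    and xstar :: "nat \<Rightarrow> (nat \<Rightarrow> real)"
    and T :: nat
  assumes m_pos: "m \<ge> 1"
    and gamma_pos: "\<forall>i<m. \<gamma> i > 0"
    \<comment> \<open>Assumption A1\<close>
    and tau_pos: "\<forall>i<m. \<tau> i > 0"
    and f_sc: "\<forall>i<m. strongly_convex_Rn (n i) (\<tau> i) (f i)"
    and X_ncc: "\<forall>i<m. ncc_set (n i) (X i)"
    and G_pos: "\<forall>i<m. G i > 0"
    and G_bound: "\<forall>i<m. \<forall>y\<in>X i. norm (matvec (n i) (A i) y - b i) \<le> G i"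
    \<comment> \<open>Assumption A2\<close>
    and E_sub: "\<forall>t. E t \<subseteq> {..<m} \<times> {..<m}"
    and A2: "B_connected m E Bc"
    \<comment> \<open>stepsize constant\<close>
    and q_pos: "q > 0"
    and q_cond: "q * (\<Sum>j<m. \<gamma> j) / real m \<ge> 4"
    \<comment> \<open>Algorithm DRDGA with beta[t] = q / t\<close>
    and rho0: "\<forall>i<m. \<rho> i 0 = 1"
    and u_upd: "\<forall>t. \<forall>i<m. u i (Suc t) = (\<Sum>j<m. Wmat m E t i j *\<^sub>R \<theta> j t)"
    and rho_upd: "\<forall>t. \<forall>i<m. \<rho> i (Suc t) = (\<Sum>j<m. Wmat m E t i j * \<rho> j t)"
    and lam_upd: "\<forall>t. \<forall>i<m. lam i (Suc t) = (1 / \<rho> i (Suc t)) *\<^sub>R u i (Suc t)"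
    and x_upd: "\<forall>t. \<forall>i<m. x i (Suc t) \<in> X i \<and>
        (\<forall>y\<in>X i. Lag (f i) (n i) (A i) (b i) (\<gamma> i) (x i (Suc t)) (lam i (Suc t))
                  \<le> Lag (f i) (n i) (A i) (b i) (\<gamma> i) y (lam i (Suc t)))"
    and theta_upd: "\<forall>t. \<forall>i<m. \<theta> i (Suc t) = u i (Suc t) +
        (q / real (Suc t)) *\<^sub>R (matvec (n i) (A i) (x i (Suc t)) - b i - \<gamma> i *\<^sub>R lam i (Suc t))"
    \<comment> \<open>bound D on the dual iterates\<close>
    and D_bound: "\<forall>i<m. \<forall>t\<ge>1. norm (lam i t) \<le> D"
    \<comment> \<open>xstar is an optimal solution of the problem\<close>
    and xstar_feas: "(\<forall>i<m. xstar i \<in> X i) \<and> (\<Sum>i<m. matvec (n i) (A i) (xstar i) - b i) = 0"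
    and xstar_opt: "\<forall>y. (\<forall>i<m. y i \<in> X i) \<and> (\<Sum>i<m. matvec (n i) (A i) (y i) - b i) = 0
        \<longrightarrow> (\<Sum>i<m. f i (xstar i)) \<le> (\<Sum>i<m. f i (y i))"
    and T_ge: "T \<ge> 2"
  shows "(\<Sum>i<m. f i (\<lambda>k. (\<Sum>t=1..T. real (t - 1) * x i t k) / (real T * (real T - 1) / 2)))
           - (\<Sum>i<m. f i (xstar i))
         \<le> 32 / (real T * delta_const m E) * (\<Sum>i<m. G i + \<gamma> i * D) *
             (eta_const m Bc / (1 - eta_const m Bc) * (\<Sum>i<m. l1norm (\<theta> i 0))
              + q * real m * (MAX i\<in>{..<m}. sqrt (real CARD('p)) * (G i + \<gamma> i * D))
                / (1 - eta_const m Bc) * (1 + ln (real T)))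
           + q / real T * (\<Sum>i<m. (G i + \<gamma> i * D)\<^sup>2)"
proof -
  define C where "C i = G i + \<gamma> i * D" for i
  define B where "B = (MAX i\<in>{..<m}. sqrt (real CARD('p)) * C i)"
  define h where "h i t = matvec (n i) (A i) (x i t) - b i" for i t
  define hs where "hs i = matvec (n i) (A i) (xstar i) - b i" for i
  define g where "g i t = h i t - \<gamma> i *\<^sub>R lam i t" for i t
  \<comment> \<open>The initial \<open>\<theta>\<close> is treated as the perturbation at time 0, as
    \<open>consensus\<close> expects.\<close>
  define \<epsilon> where "\<epsilon> i t = (if t = 0 then \<theta> i 0 else (q / real t) *\<^sub>R g i t)" for i t
  define th where "th t = (1 / real m) *\<^sub>R (\<Sum>i<m. \<theta> i t)" for t
  define \<delta> where "\<delta> = delta_const m E"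
  define \<eta> where "\<eta> = eta_const m Bc"
  define e where "e s = (\<Sum>j<m. norm (\<epsilon> j s))" for s
  define K where "K t = 2 / \<delta> * (\<Sum>s<t. \<eta> ^ (t - s) * e s)" for t
  define gap where "gap t = (\<Sum>i<m. f i (x i t)) - (\<Sum>i<m. f i (xstar i))" for t
  define CC where "CC = (\<Sum>i<m. (C i)\<^sup>2)"
  define w where "w = real T * (real T - 1) / 2"
  define Z where "Z = \<eta> / (1 - \<eta>) * (\<Sum>i<m. l1norm (\<theta> i 0)) + q * real m * B / (1 - \<eta>) * (1 + ln (real T))"

  have m: "real m > 0" using m_pos by simp
  have Bc: "Bc > 0" using A2 by (simp add: B_connected_def)
  have \<eta>: "0 \<le> \<eta>" "\<eta> < 1" using eta_const_bounds[OF m_pos Bc] by (auto simp: \<eta>_def)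
  have \<delta>: "\<delta> > 0" using delta_const_bounds(1)[OF A2 E_sub m_pos] by (simp add: \<delta>_def)
  have \<rho>: "\<rho> i t = Wmass m E t i" if "i < m" for i t
    using that
  proof (induction t arbitrary: i)
    case 0 then show ?case using rho0 by (simp add: Wm.mass_0)
  next
    case (Suc t) then show ?case using rho_upd by (simp add: Wm.mass_Suc)
  qed
  have \<rho>_ge: "\<delta> \<le> Wmass m E (Suc t) i" if "i < m" for i t
    using delta_const_bounds(2)[OF A2 E_sub m_pos that] by (simp add: \<delta>_def)
  have \<gamma>0: "0 \<le> \<gamma> i" if "i < m" for i using gamma_pos that by (simp add: less_imp_le)
  have lam_D: "norm (lam i (Suc t)) \<le> D" if "i < m" for i t using D_bound that by simp
  have D0: "0 \<le> D" using lam_D[of 0 0] m_pos norm_ge_zero order_trans by (metis less_le_trans zero_less_one)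
  have h_G: "norm (h i (Suc t)) \<le> G i" if "i < m" for i t
    using G_bound x_upd that by (simp add: h_def)
  have hs_G: "norm (hs i) \<le> G i" if "i < m" for i
    using G_bound xstar_feas that by (simp add: hs_def)
  have C0: "0 \<le> C i" if "i < m" for i
    using \<gamma>0[OF that] D0 G_pos that by (simp add: C_def less_imp_le)
  have g_C: "norm (g i (Suc t)) \<le> C i" if "i < m" for i t
  proof -
    have "norm (g i (Suc t)) \<le> norm (h i (Suc t)) + norm (\<gamma> i *\<^sub>R lam i (Suc t))"
      unfolding g_def by (rule norm_triangle_ineq4)
    also have "\<dots> \<le> C i" unfolding C_def
      using h_G[OF that] lam_D[OF that] \<gamma>0[OF that] by (auto intro!: add_mono mult_left_mono)
    finally show ?thesis .
  qed
  \<comment> \<open>The factor \<open>sqrt p\<close> is at least 1, so the Euclidean bound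
    \<open>C i\<close> passes to \<open>B\<close>.\<close>
  have C_B: "C i \<le> B" if "i < m" for i
  proof -
    have "1 \<le> sqrt (real CARD('p))" by simp
    then have "C i \<le> sqrt (real CARD('p)) * C i" using C0[OF that] mult_right_mono[of 1 _ "C i"] by simp
    also have "\<dots> \<le> B" unfolding B_def using that by (intro Max_ge) auto
    finally show ?thesis .
  qed
  have B0: "0 \<le> B" using C0[of 0] C_B[of 0] m_pos by simp

  \<comment> \<open>Consensus around the averaged dual iterate\<close>
  note upd = u_upd[rule_format]
  have \<theta>_0: "\<theta> i 0 = \<epsilon> i 0" for i by (simp add: \<epsilon>_def)
  have \<theta>_Suc: "\<theta> i (Suc t) = u i (Suc t) + \<epsilon> i (Suc t)" if "i < m" for i t
    using theta_upd that by (simp add: \<epsilon>_def g_def h_def)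
  have u_lam: "u i (Suc t) = Wmass m E (Suc t) i *\<^sub>R lam i (Suc t)" if "i < m" for i t
    using lam_upd that \<rho>[OF that] \<rho>_ge[OF that, of t] \<delta> by simp
  have u_tot: "(\<Sum>i<m. u i (Suc t)) = (\<Sum>i<m. \<theta> i t)" for t
    by (rule Wm.u_total[OF upd \<theta>_0 \<theta>_Suc])

  \<comment> \<open>Totals are preserved and \<open>u\<close> is mass times \<open>lam\<close>, so
    \<open>th t\<close> is a convex combination of the \<open>lam i (Suc t)\<close> with weights
    mass over \<open>m\<close>.\<close>
  have th_D: "norm (th t) \<le> D" for t
  proof -
    have "norm (\<Sum>i<m. \<theta> i t) = norm (\<Sum>i<m. Wmass m E (Suc t) i *\<^sub>R lam i (Suc t))"
      using u_lam by (simp add: u_tot[symmetric])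
    also have "\<dots> \<le> (\<Sum>i<m. Wmass m E (Suc t) i * D)"
      using lam_D Wm.mass_nonneg
      by (intro order_trans[OF norm_sum] sum_mono) (auto intro!: mult_left_mono)
    also have "\<dots> = real m * D" by (simp only: sum_distrib_right[symmetric] Wm.mass_total)
    finally show ?thesis using m by (simp add: th_def field_simps)
  qed
  have th_Suc: "th (Suc t) = th t + ((q / real (Suc t)) / real m) *\<^sub>R (\<Sum>i<m. g i (Suc t))" for t
    using \<theta>_Suc by (simp add: th_def sum.distrib u_tot \<epsilon>_def scaleR_add_right scaleR_sum_right[symmetric])
  have K: "norm (lam i (Suc t) - th t) \<le> K (Suc t)" if "i < m" for i t
  proof -
    have "norm ((1 / Wmass m E (Suc t) i) *\<^sub>R u i (Suc t) - (1 / real m) *\<^sub>R (\<Sum>j<m. \<theta> j t))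
      \<le> 2 / \<delta> * (\<Sum>s\<le>t. \<eta> ^ (Suc t - s) * (\<Sum>j<m. norm (\<epsilon> j s)))"
      by (rule Wm.consensus[OF upd \<theta>_0 \<theta>_Suc])
        (use Wprod_row_gap[OF A2 E_sub] \<rho>_ge \<delta> \<eta> that in \<open>auto simp: \<eta>_def\<close>)
    then show ?thesis using lam_upd that \<rho> by (simp add: th_def K_def e_def lessThan_Suc_atMost)
  qed

  \<comment> \<open>Primal gap at a single time\<close>
  have gap_le: "gap t \<le> 2 * K t * (\<Sum>i<m. C i)
      + (real m * real t / (2 * q) * ((norm (th (t - 1)))\<^sup>2 - (norm (th t))\<^sup>2) - (\<Sum>i<m. \<gamma> i) * (norm (th (t - 1)))\<^sup>2)
      + q / 2 * CC / real t" if t1: "t \<ge> 1" for t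
  proof -
    obtain t' where t: "t = Suc t'" using t1 by (cases t) auto
    have "gap t \<le> 2 * K t * (\<Sum>i<m. G i + \<gamma> i * D)
      + (real m / (2 * (q / real t)) * ((norm (th t'))\<^sup>2 - (norm (th t))\<^sup>2) - (\<Sum>i<m. \<gamma> i) * (norm (th t'))\<^sup>2)
      + (q / real t) / 2 * (\<Sum>i<m. (G i + \<gamma> i * D)\<^sup>2)"
      unfolding gap_def
    proof (rule dual_step_gap)
      show "f i (x i t) + lam i t \<bullet> h i t \<le> f i (xstar i) + lam i t \<bullet> hs i" if "i < m" for i
        using x_upd xstar_feas that by (simp add: Lag_def h_def hs_def t)
      show "(\<Sum>i<m. hs i) = 0" using xstar_feas by (simp add: hs_def)
      show "th t = th t' + (q / real t / real m) *\<^sub>R (\<Sum>i<m. h i t - \<gamma> i *\<^sub>R lam i t)"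
        using th_Suc[of t'] by (simp add: t g_def)
    qed (use m_pos q_pos \<gamma>0 h_G hs_G lam_D th_D K t in auto)
    then show ?thesis by (simp add: t C_def CC_def mult_ac)
  qed

  \<comment> \<open>Weighted sums of the consensus, telescoping and noise terms\<close>
  have e_nonneg: "0 \<le> e s" for s by (simp add: e_def sum_nonneg)
  have e_0: "e 0 \<le> (\<Sum>i<m. l1norm (\<theta> i 0))"
    by (auto simp: e_def \<epsilon>_def intro!: sum_mono norm_le_l1norm)
  have e_Suc: "e s \<le> q * real m * B / real s" if s: "s \<ge> 1" for s
  proof -
    obtain s' where s': "s = Suc s'" using s by (cases s) auto
    have "e s \<le> (\<Sum>j<m. q / real s * B)" unfolding e_def
      using g_C C_B q_pos by (intro sum_mono) (auto simp: \<epsilon>_def s' intro!: mult_left_mono divide_right_mono intro: order_trans)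
    then show ?thesis by (simp add: mult_ac)
  qed
  have conv: "(\<Sum>t=1..T. \<Sum>s<t. \<eta> ^ (t - s) * e s) \<le> Z"
    unfolding Z_def by (rule geometric_convolution_le) (use \<eta> e_nonneg e_0 e_Suc T_ge in auto)
  have K_nonneg: "0 \<le> K t" for t
    unfolding K_def using \<delta> \<eta> e_nonneg by (intro mult_nonneg_nonneg sum_nonneg) auto
  \<comment> \<open>Bounding the weights by \<open>T - 1\<close> leaves a factor that later cancels
    against \<open>w\<close>.\<close>
  have "(\<Sum>t=1..T. real (t - 1) * K t) \<le> (\<Sum>t=1..T. (real T - 1) * K t)"
    using K_nonneg by (intro sum_mono mult_right_mono) auto
  also have "\<dots> = (real T - 1) * (2 / \<delta> * (\<Sum>t=1..T. \<Sum>s<t. \<eta> ^ (t - s) * e s))"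
    by (simp only: K_def sum_distrib_left)
  also have "\<dots> \<le> (real T - 1) * (2 / \<delta> * Z)"
    using conv \<delta> T_ge by (intro mult_left_mono) auto
  finally have K_sum: "(\<Sum>t=1..T. real (t - 1) * K t) \<le> (real T - 1) * (2 / \<delta> * Z)" .
  have Z0: "0 \<le> Z"
    using \<eta> q_pos B0 T_ge
    by (auto simp: Z_def l1norm_def intro!: add_nonneg_nonneg mult_nonneg_nonneg divide_nonneg_nonneg sum_nonneg)
  have C_sum: "0 \<le> (\<Sum>i<m. C i)" using C0 by (auto intro: sum_nonneg)
  have CC0: "0 \<le> CC" by (simp add: CC_def sum_nonneg)

  let ?d = "\<lambda>t. real m * real t / (2 * q) * ((norm (th (t - 1)))\<^sup>2 - (norm (th t))\<^sup>2) - (\<Sum>i<m. \<gamma> i) * (norm (th (t - 1)))\<^sup>2"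
  \<comment> \<open>\<open>q_cond\<close> gives
    \<open>q * (\<Sum>i<m. \<gamma> i) \<ge> 4 * m\<close>, which covers the condition of
    \<open>weighted_telescope\<close>.\<close>
  have "real m \<le> q * (\<Sum>i<m. \<gamma> i)" using q_cond m by (simp add: field_simps)
  then have "(\<Sum>t=1..T. real (t - 1) * ?d t) \<le> - (real T * (real T - 1) * real m / (2 * q) * (norm (th T))\<^sup>2)"
    using weighted_telescope[of "\<lambda>t. (norm (th t))\<^sup>2" q "real m" "\<Sum>i<m. \<gamma> i" T] q_pos by simp
  also have "\<dots> \<le> 0" using q_pos T_ge by simp
  finally have tele: "(\<Sum>t=1..T. real (t - 1) * ?d t) \<le> 0" .
  \<comment> \<open>The term at \<open>t = 1\<close> vanishes, which leaves \<open>T - 1\<close>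
    terms of size at most \<open>q / 2 * CC\<close>.\<close>
  have "(\<Sum>t=1..T. real (t - 1) * (q / 2 * CC / real t)) \<le> (\<Sum>t=2..T. q / 2 * CC)"
  proof -
    have "(\<Sum>t=1..T. real (t - 1) * (q / 2 * CC / real t)) = (\<Sum>t=2..T. real (t - 1) * (q / 2 * CC / real t))"
      by (rule sum.mono_neutral_right) auto
    also have "\<dots> \<le> (\<Sum>t=2..T. q / 2 * CC)"
    proof (rule sum_mono)
      fix t assume t: "t \<in> {2..T}"
      have "real (t - 1) / real t * (q / 2 * CC) \<le> 1 * (q / 2 * CC)"
        using t q_pos CC0 by (intro mult_right_mono) auto
      then show "real (t - 1) * (q / 2 * CC / real t) \<le> q / 2 * CC" by simp
    qed
    finally show ?thesis .
  qed
  also have "\<dots> = (real T - 1) * (q / 2 * CC)" using T_ge by (simp add: of_nat_diff)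
  finally have noise: "(\<Sum>t=1..T. real (t - 1) * (q / 2 * CC / real t)) \<le> (real T - 1) * (q / 2 * CC)" .

  have "(\<Sum>t=1..T. real (t - 1) * gap t)
      \<le> (\<Sum>t=1..T. real (t - 1) * (2 * K t * (\<Sum>i<m. C i) + ?d t + q / 2 * CC / real t))"
    using gap_le by (intro sum_mono mult_left_mono) auto
  also have "\<dots> = 2 * (\<Sum>i<m. C i) * (\<Sum>t=1..T. real (t - 1) * K t)
      + (\<Sum>t=1..T. real (t - 1) * ?d t) + (\<Sum>t=1..T. real (t - 1) * (q / 2 * CC / real t))"
    unfolding distrib_left sum.distrib sum_distrib_left[of "2 * (\<Sum>i<m. C i)"] by (simp only: mult_ac)
  also have "\<dots> \<le> 2 * (\<Sum>i<m. C i) * ((real T - 1) * (2 / \<delta> * Z)) + 0 + (real T - 1) * (q / 2 * CC)"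
    using K_sum C_sum tele noise by (intro add_mono mult_left_mono) auto
  finally have total: "(\<Sum>t=1..T. real (t - 1) * gap t)
      \<le> (real T - 1) * (4 / \<delta> * (\<Sum>i<m. C i) * Z + q / 2 * CC)"
    by (simp add: algebra_simps)

  \<comment> \<open>Passage to the averaged primal iterate\<close>
  have w: "w > 0" using T_ge by (simp add: w_def)
  have w_sum: "(\<Sum>t=1..T. real (t - 1)) = w" by (simp only: sum_pred_weights w_def)
  have "(\<Sum>i<m. f i (\<lambda>k. (\<Sum>t=1..T. real (t - 1) * x i t k) / w))
      \<le> (\<Sum>i<m. (\<Sum>t=1..T. real (t - 1) * f i (x i t)) / w)"
  proof (rule sum_mono)
    fix i assume "i \<in> {..<m}"
    then have i: "i < m" by simp
    have "x i t \<in> Rn (n i)" if "t \<ge> 1" for t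
      using x_upd[rule_format, OF i, of "t - 1"] X_ncc i that by (auto simp: ncc_set_def)
    then show "f i (\<lambda>k. (\<Sum>t=1..T. real (t - 1) * x i t k) / w) \<le> (\<Sum>t=1..T. real (t - 1) * f i (x i t)) / w"
      unfolding w_def using f_sc tau_pos i T_ge
      by (intro strongly_convex_average[of _ "\<tau> i"]) (auto simp: less_imp_le)
  qed
  also have "\<dots> = (\<Sum>t=1..T. real (t - 1) * (\<Sum>i<m. f i (x i t))) / w"
    by (simp only: sum_divide_distrib[symmetric] sum_distrib_left, subst sum.swap, rule refl)
  also have "\<dots> = (\<Sum>t=1..T. real (t - 1) * gap t) / w + (\<Sum>i<m. f i (xstar i))"
    unfolding gap_def right_diff_distrib sum_subtractf sum_distrib_right[symmetric] w_sum
    using w by (simp add: diff_divide_distrib)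
  finally have "(\<Sum>i<m. f i (\<lambda>k. (\<Sum>t=1..T. real (t - 1) * x i t k) / w)) - (\<Sum>i<m. f i (xstar i))
      \<le> (\<Sum>t=1..T. real (t - 1) * gap t) / w" by simp
  also have "\<dots> \<le> ((real T - 1) * (4 / \<delta> * (\<Sum>i<m. C i) * Z + q / 2 * CC)) / w"
    using total w by (intro divide_right_mono) auto
  \<comment> \<open>Dividing by \<open>w = T * (T - 1) / 2\<close> cancels \<open>T - 1\<close> and
    doubles the constants 4 and \<open>q / 2\<close>.\<close>
  also have "\<dots> = 8 / (real T * \<delta>) * (\<Sum>i<m. C i) * Z + q / real T * CC"
    using T_ge \<delta> by (simp add: w_def divide_simps)
  \<comment> \<open>Since the sum of the \<open>C i\<close> and \<open>Z\<close> are nonnegative, 8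
    may be enlarged to the stated 32.\<close>
  also have "\<dots> \<le> 32 / (real T * \<delta>) * (\<Sum>i<m. C i) * Z + q / real T * CC"
    using T_ge \<delta> C_sum Z0 by (intro add_right_mono mult_right_mono divide_right_mono) auto
  finally show ?thesis
    unfolding w_def Z_def \<delta>_def \<eta>_def B_def C_def CC_def .
qed

end
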